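(* Let $p > 1$ and let $\{X_{n,k}, \, 1 \leqslant k \leqslant n, n \geqslant 1\}$ be an array of random variables satisfying $\mathbb{E}|X_{n,k}|^{p} < \infty$ for each $1 \leqslant k \leqslant n$ and all $n \geqslant 1$. Suppose that for some $q > p$ and some sequence $\{\alpha_{n}\}$ of positive numbers, $$\mathbb{E}\left|\sum_{k=1}^{n}\left[g_{t}(X_{n,k}) - \mathbb{E}\, g_{t}(X_{n,k})\right]\right|^{q} \leqslant \alpha_{n}\sum_{k=1}^{n}\mathbb{E}\,|g_{t}(X_{n,k})|^{q}\quad\text{for all } n \geqslant 1 \text{ and } t > 0.$$ If $\{b_{n}\}$, $\{c_{n}\}$ are real sequences of positive numbers such that (a) $\sum_{n=1}^{\infty}\sum_{k=1}^{n}\alpha_{n}c_{n}b_{n}^{-q}\int_{0}^{b_{n}^{q}}\mathbb{P}\{|X_{n,k}|^{q} > t\}\,\mathrm{d}t < \infty$, (b) $\sum_{n=1}^{\infty}\sum_{k=1}^{n}c_{n}\,\mathbb{E}\left[|X_{n,k}| I_{\{|X_{n,k}| > b_{n}\}}\right]/b_{n} < \infty$, (c) $\sum_{n=1}^{\infty}\sum_{k=1}^{n}(1+\alpha_{n})c_{n}b_{n}^{-p}\int_{b_{n}^{p}}^{\infty}\mathbb{P}\{|X_{n,k}|^{p} > t\}\,\mathrm{d}t < \infty$, then $$\sum_{n=1}^{\infty}c_{n}\,\mathbb{E}\left[\frac{\left|\sum_{k=1}^{n}(X_{n,k} - \mathbb{E}\,X_{n,k})\right|}{b_{n}} - \varepsilon\right]_{+}^{p}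 < \infty$$ for all $\varepsilon > 0$.
   Context: Notation: $x_{+} = \max(x,0)$, and $[\,\cdot\,]_{+}^{p}$ means $([\,\cdot\,]_{+})^{p}$ (inside the expectation). $I_{A}$ is the indicator random variable of the event $A$. For $t>0$, $g_{t}(x) = \max(\min(x,t),-t)$ is truncation at level $t$. *)

theory Defs
  imports "HOL-Probability.Probability"
begin

definition trunc :: "real \<Rightarrow> real \<Rightarrow> real" where
  "trunc t x = max (min x t) (- t)"

definition pos_part :: "real \<Rightarrow> real" where
  "pos_part x = max x 0"

end

theory Submission
  imports Defs
begin

text \<open>
  For fixed \<open>n\<close> and a level \<open>s\<close>, the centred sum \<open>S\<close> is bounded by the centred sum \<open>T s\<close> of the
  variables truncated at \<open>s\<close>, plus the sum of the excesses \<open>(\<bar>X k\<bar> - s)\<^sub>+\<close>, plus the mean of that sum.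
  The part of \<open>(\<bar>S\<bar> / b - \<epsilon>)\<^sub>+\<close> below level 3 is handled by the single truncation level \<open>b\<close>: there
  \<open>(x - \<epsilon>)\<^sub>+\<close> to the power \<open>p\<close> is dominated by a multiple of \<open>x\<close> to the power \<open>q\<close>, and the excesses are
  only needed to first order. The part above level 3 is the integral of \<open>p s\<^sup>p\<^sup>-\<^sup>1 P(\<bar>S\<bar> > 3 s)\<close>
  over \<open>s > b\<close>, where the truncation level is taken to be \<open>s\<close> itself: \<open>T s\<close> is controlled by Markov's
  inequality and the moment hypothesis, the excesses vanish unless some \<open>\<bar>X k\<bar> > s\<close>, and their mean is
  at most \<open>s\<close> once \<open>s\<^sup>p\<close> exceeds \<open>V = \<Sum> E (\<bar>X k\<bar>\<^sup>p - b\<^sup>p)\<^sub>+\<close>, so the remaining levels contribute at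
  most \<open>V\<close>.
\<close>

section \<open>Tail probabilities integrated over the level\<close>

text \<open>Written as an integral over \<open>M\<close> of an indicator in \<open>\<omega>\<close>
  and \<open>t\<close>, the tail inherits measurability in \<open>t\<close> and becomes accessible
  to Tonelli.\<close>

lemma (in prob_space) tail_eq_nn_integral:
  fixes Z :: "'a \<Rightarrow> real"
  assumes [measurable]: "Z \<in> borel_measurable M"
  shows "ennreal \<P>(\<omega> in M. Z \<omega> > t) = (\<integral>\<^sup>+\<omega>. indicator {..<Z \<omega>} t \<partial>M)"
proof -
  have "(\<integral>\<^sup>+\<omega>. indicator {..<Z \<omega>} t \<partial>M) = (\<integral>\<^sup>+\<omega>. indicator {\<omega>\<in>space M. Z \<omega> > t} \<omega> \<partial>M)"
    by (intro nn_integral_cong) (auto split: split_indicator)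
  then show ?thesis by (simp add: emeasure_eq_measure)
qed

lemma (in prob_space) borel_measurable_tail:
  fixes Z :: "'a \<Rightarrow> real"
  assumes [measurable]: "Z \<in> borel_measurable M"
  shows "(\<lambda>t. ennreal \<P>(\<omega> in M. Z \<omega> > t)) \<in> borel_measurable borel"
  unfolding tail_eq_nn_integral[OF assms] lessThan_def by measurable

text \<open>Tonelli on the region \<open>t < Z \<omega>\<close>. The weight is left free because it
  serves as the indicator of \<open>{0..B}\<close>, as that of \<open>{B..}\<close>, and as the
  density \<open>p * s powr (p - 1)\<close> on \<open>{b<..}\<close>.\<close>

lemma (in prob_space) nn_integral_weighted_tail:
  fixes Z :: "'a \<Rightarrow> real" and w :: "real \<Rightarrow> ennreal"
  assumes [measurable]: "Z \<in> borel_measurable M" "w \<in> borel_measurable borel"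
  shows "(\<integral>\<^sup>+t. w t * ennreal \<P>(\<omega> in M. Z \<omega> > t) \<partial>lborel)
    = (\<integral>\<^sup>+\<omega>. (\<integral>\<^sup>+t. w t * indicator {..<Z \<omega>} t \<partial>lborel) \<partial>M)"
proof -
  interpret pair_sigma_finite M lborel ..
  have "w t * ennreal \<P>(\<omega> in M. Z \<omega> > t) = (\<integral>\<^sup>+\<omega>. w t * indicator {..<Z \<omega>} t \<partial>M)" for t
    unfolding tail_eq_nn_integral[OF assms(1)] lessThan_def
    by (rule nn_integral_cmult[symmetric]) measurable
  then show ?thesis
    by (simp only:) (rule Fubini', simp add: lessThan_def, measurable)
qed

text \<open>For a fixed value \<open>z\<close> of \<open>Z\<close>, the levels of
  \<open>{0..B}\<close> below \<open>z\<close> form an interval of length \<open>min z B\<close>.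
  With \<open>Z\<close> the q-th power of an absolute value, this evaluates the integral in
  (a).\<close>

lemma (in prob_space) nn_integral_tail_Icc:
  fixes Z :: "'a \<Rightarrow> real"
  assumes [measurable]: "Z \<in> borel_measurable M" and "\<And>\<omega>. 0 \<le> Z \<omega>" "0 \<le> B"
  shows "(\<integral>\<^sup>+t\<in>{0..B}. ennreal \<P>(\<omega> in M. Z \<omega> > t) \<partial>lborel) = (\<integral>\<^sup>+\<omega>. ennreal (min (Z \<omega>) B) \<partial>M)"
proof -
  have "(\<integral>\<^sup>+t. indicator {0..B} t * indicator {..<z} t \<partial>lborel) = ennreal (min z B)" if "0 \<le> z" for z
  proof -
    have "{0..B} \<inter> {..<z} = (if z \<le> B then {0..<z} else {0..B})" by auto
    then show ?thesis
      using that assms(3) by (simp flip: indicator_inter_arith add: min_def)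
  qed
  then show ?thesis
    using assms(2) nn_integral_weighted_tail[of Z "indicator {0..B}"]
    by (subst mult.commute) simp
qed

text \<open>The levels from \<open>B\<close> up to a value \<open>z\<close> have total length
  \<open>max (z - B) 0\<close>. With \<open>Z\<close> the p-th power of an absolute value, this
  evaluates the integral in (c).\<close>

lemma (in prob_space) nn_integral_tail_atLeast:
  fixes Z :: "'a \<Rightarrow> real"
  assumes [measurable]: "Z \<in> borel_measurable M"
  shows "(\<integral>\<^sup>+t\<in>{B..}. ennreal \<P>(\<omega> in M. Z \<omega> > t) \<partial>lborel) = (\<integral>\<^sup>+\<omega>. ennreal (max (Z \<omega> - B) 0) \<partial>M)"
proof -
  have "(\<integral>\<^sup>+t. indicator {B..} t * indicator {..<z} t \<partial>lborel) = ennreal (max (z - B) 0)" for z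
  proof -
    have "{B..} \<inter> {..<z} = (if z \<le> B then {} else {B..<z})" by auto
    then show ?thesis
      by (simp flip: indicator_inter_arith add: max_def)
  qed
  then show ?thesis
    using nn_integral_weighted_tail[of Z "indicator {B..}"]
    by (subst mult.commute) simp
qed

section \<open>Integrals of powers over levels above \<open>b\<close>\<close>

text \<open>The weight is the derivative of \<open>s powr p\<close>, that is, the layer-cake density
  of a p-th moment, with the levels up to \<open>b\<close> removed.\<close>

lemma nn_integral_powr_Ioo:
  fixes p b y :: real
  assumes "0 < b" "0 < p" "0 \<le> y"
  shows "(\<integral>\<^sup>+s. ennreal (p * s powr (p - 1)) * indicator {b<..} s * indicator {..<y} s \<partial>lborel)
    = ennreal (max (y powr p - b powr p) 0)"
proof (cases "b \<le> y")
  case True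
  have "(\<integral>\<^sup>+s. ennreal (p * s powr (p - 1)) * indicator {b<..} s * indicator {..<y} s \<partial>lborel)
    = (\<integral>\<^sup>+s. ennreal (p * s powr (p - 1)) * indicator {b..y} s \<partial>lborel)"
    \<comment> \<open>The open and the closed interval differ only in the null points
      \<open>b\<close> and \<open>y\<close>.\<close>
    using AE_lborel_singleton[of b] AE_lborel_singleton[of y]
    by (intro nn_integral_cong_AE) (auto split: split_indicator)
  also have "\<dots> = ennreal (y powr p - b powr p)"
    by (rule nn_integral_FTC_Icc)
      (use assms True in \<open>auto intro!: derivative_eq_intros\<close>)
  also have "\<dots> = ennreal (max (y powr p - b powr p) 0)"
    using assms True by (simp add: powr_mono2 max_absorb1)
  finally show ?thesis .
next
  case False
  then have "(\<lambda>s. ennreal (p * s powr (p - 1)) * indicator {b<..} s * indicator {..<y} s) = (\<lambda>s. 0)"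
    by (auto split: split_indicator)
  moreover have "y powr p \<le> b powr p"
    using assms False by (intro powr_mono2) auto
  ultimately show ?thesis by (simp add: max_absorb2)
qed

lemma nn_integral_powr_atLeast:
  fixes a y :: real
  assumes "0 < y" "0 < a"
  shows "(\<integral>\<^sup>+s. ennreal (s powr (- a - 1)) * indicator {y..} s \<partial>lborel) = ennreal (y powr (- a) / a)"
proof -
  have "((\<lambda>s. - (s powr (- a) / a)) \<longlongrightarrow> - (0 / a)) at_top"
    using assms by (intro tendsto_intros tendsto_neg_powr filterlim_ident) auto
  then have "(\<integral>\<^sup>+s. ennreal (s powr (- a - 1)) * indicator {y..} s \<partial>lborel) = ennreal (0 - (- (y powr (- a) / a)))"
    by (intro nn_integral_FTC_atLeast[where F = "\<lambda>s. - (s powr (- a) / a)"])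
      (use assms in \<open>auto intro!: derivative_eq_intros\<close>)
  then show ?thesis by simp
qed

text \<open>This is the integrated Markov bound for one variable with value \<open>x\<close>. Levels
  below \<open>x\<close> have \<open>s powr (- q) * min x s powr q = 1\<close> and give the excess
  of p-th powers. Levels beyond \<open>x\<close> leave a multiple of
  \<open>s powr (p - 1 - q)\<close>, integrable at infinity because \<open>p < q\<close>; this is
  the source of the factor \<open>p / (q - p)\<close>.\<close>

lemma nn_integral_min_powr_le:
  fixes p q b x :: real
  assumes "0 < p" "p < q" "0 < b" "0 \<le> x"
  shows "(\<integral>\<^sup>+s. ennreal (p * s powr (p - 1)) * indicator {b<..} s * ennreal (s powr (- q) * min x s powr q) \<partial>lborel)
    \<le> ennreal ((1 + p / (q - p)) * max (x powr p - b powr p) 0 + p / (q - p) * (b powr (p - q) * min x b powr q))"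
    (is "?L \<le> _")
proof -
  define y where "y = max x b"
  have y: "0 < y" "x \<le> y" "b \<le> y" using assms by (auto simp: y_def)
  let ?D = "max (x powr p - b powr p) 0"
  \<comment> \<open>For \<open>s > b\<close>, either \<open>s < x\<close> and the first summand is
    the integrand, or \<open>s \<ge> y\<close> and the second one is.\<close>
  have pw: "ennreal (p * s powr (p - 1)) * indicator {b<..} s * ennreal (s powr (- q) * min x s powr q)
    \<le> ennreal (p * s powr (p - 1)) * indicator {b<..} s * indicator {..<x} s
      + ennreal (p * x powr q) * (ennreal (s powr (- (q - p) - 1)) * indicator {y..} s)" for s
  proof (cases "b < s")
    case True
    then have s: "0 < s" using assms by simp
    show ?thesis
    proof (cases "s < x")
      case True
      then have "s powr (- q) * min x s powr q = 1"
        using s by (simp flip: powr_add)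
      with True show ?thesis by simp
    next
      case False
      have "s powr (p - 1) * s powr (- q) = s powr (- (q - p) - 1)"
        by (simp add: algebra_simps flip: powr_add)
      then have "p * s powr (p - 1) * (s powr (- q) * min x s powr q) = p * x powr q * s powr (- (q - p) - 1)"
        using False by (simp add: min_def mult.assoc mult.left_commute mult.commute)
      then have "ennreal (p * s powr (p - 1)) * ennreal (s powr (- q) * min x s powr q)
        = ennreal (p * x powr q) * ennreal (s powr (- (q - p) - 1))"
        using assms by (simp only: ennreal_mult[symmetric] mult_nonneg_nonneg powr_ge_zero less_imp_le)
      then show ?thesis
        using False \<open>b < s\<close> by (simp add: y_def)
    qed
  qed simp
  have "?L \<le> (\<integral>\<^sup>+s. ennreal (p * s powr (p - 1)) * indicator {b<..} s * indicator {..<x} s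
      + ennreal (p * x powr q) * (ennreal (s powr (- (q - p) - 1)) * indicator {y..} s) \<partial>lborel)"
    by (intro nn_integral_mono pw)
  also have "\<dots> = ennreal ?D + ennreal (p * x powr q) * ennreal (y powr (- (q - p)) / (q - p))"
    using assms y nn_integral_powr_Ioo[of b p x] nn_integral_powr_atLeast[of y "q - p"]
    by (subst nn_integral_add) (auto simp: nn_integral_cmult)
  also have "\<dots> = ennreal (?D + p / (q - p) * (x powr q * y powr (p - q)))"
  proof -
    have eq: "ennreal d + ennreal u * ennreal v = ennreal (d + u * v)" if "0 \<le> d" "0 \<le> u" "0 \<le> v" for d u v
      using that by (simp flip: ennreal_mult ennreal_plus)
    show ?thesis
      using assms by (subst eq) (auto simp: mult.assoc)
  qed
  also have "\<dots> \<le> ennreal ((1 + p / (q - p)) * ?D + p / (q - p) * (b powr (p - q) * min x b powr q))"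
  proof (rule ennreal_leI)
    \<comment> \<open>Equality holds in both cases: for \<open>x \<le> b\<close> one has
      \<open>y = b\<close> and no excess, and for \<open>x > b\<close> both sides equal
      \<open>x powr p\<close>.\<close>
    have "x powr q * y powr (p - q) \<le> b powr (p - q) * min x b powr q + ?D"
    proof (cases "x \<le> b")
      case False
      then have "x powr q * y powr (p - q) = x powr p" "b powr (p - q) * min x b powr q = b powr p"
        using assms by (auto simp: y_def powr_diff)
      then show ?thesis by simp
    qed (simp add: y_def max_absorb2)
    then have "p / (q - p) * (x powr q * y powr (p - q))
      \<le> p / (q - p) * (b powr (p - q) * min x b powr q + ?D)"
      using assms by (intro mult_left_mono) auto
    then show "?D + p / (q - p) * (x powr q * y powr (p - q))
      \<le> (1 + p / (q - p)) * ?D + p / (q - p) * (b powr (p - q) * min x b powr q)"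
      by (simp only: distrib_left distrib_right) simp
  qed
  finally show ?thesis .
qed

section \<open>Truncation and elementary inequalities for powers\<close>

lemma abs_trunc: "t > 0 \<Longrightarrow> \<bar>trunc t x\<bar> = min \<bar>x\<bar> t"
  and abs_diff_trunc: "t > 0 \<Longrightarrow> \<bar>x - trunc t x\<bar> = max (\<bar>x\<bar> - t) 0"
  by (auto simp: trunc_def)

lemma measurable_trunc [measurable]: "trunc t \<in> borel_measurable borel"
  unfolding trunc_def by measurable

lemma min_powr:
  fixes x y q :: real
  assumes "0 \<le> x" "0 \<le> y" "0 \<le> q"
  shows "min (x powr q) (y powr q) = min x y powr q"
  using powr_mono2[of q x y] powr_mono2[of q y x] assms by (auto simp: min_def)

text \<open>For \<open>x \<ge> s\<close> the product \<open>s powr (p - 1) * x\<close> is at most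
  \<open>x powr p\<close>. This converts first-order excesses over \<open>s\<close> into excesses of
  p-th powers.\<close>

lemma powr_sub_diff_le:
  fixes p s x :: real
  assumes "1 \<le> p" "0 < s" "0 \<le> x"
  shows "s powr (p - 1) * max (x - s) 0 \<le> max (x powr p - s powr p) 0"
proof (cases "s \<le> x")
  case True
  have "s powr (p - 1) * x \<le> x powr (p - 1) * x"
    using assms True by (intro mult_right_mono powr_mono2) auto
  moreover have "x powr (p - 1) * x = x powr p" "s powr (p - 1) * s = s powr p"
    using assms True by (auto simp: powr_diff)
  ultimately show ?thesis using True by (simp add: algebra_simps max_def)
qed simp

text \<open>Since \<open>f\<close> is at most three times the largest of the summands, capping
  \<open>f\<close> at 3 amounts to capping that summand at 1. On [0,1] a p-th power is at most its
  base, so \<open>v\<close> and \<open>w\<close> enter only to first order, as (b) requires.\<close>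

lemma min_powr_add3_le:
  fixes p u v w f :: real
  assumes "1 \<le> p" "0 \<le> u" "0 \<le> v" "0 \<le> w" "0 \<le> f" "f \<le> u + v + w"
  shows "min f 3 powr p \<le> 3 powr p * (u powr p + v + w)"
proof -
  define m where "m = max u (max v w)"
  have le: "min z 1 powr p \<le> z" if "0 \<le> z" for z
    using powr_mono'[of 1 p "min z 1"] that assms(1) by (cases "z = 0") auto
  have "min f 3 powr p \<le> (3 * min m 1) powr p"
    using assms by (intro powr_mono2) (auto simp: m_def)
  also have "\<dots> = 3 powr p * min m 1 powr p"
    using assms by (simp add: powr_mult m_def)
  also have "min m 1 powr p \<le> u powr p + v + w"
  proof -
    consider "m = u" | "m = v" | "m = w" unfolding m_def by linarith
    then show ?thesis
    proof cases
      case 1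
      have "min u 1 powr p \<le> u powr p" using assms by (intro powr_mono2) auto
      with 1 assms show ?thesis by simp
    next
      case 2
      with le[of v] assms show ?thesis by (simp add: add_increasing add_increasing2)
    next
      case 3
      with le[of w] assms show ?thesis by (simp add: add_increasing add_increasing2)
    qed
  qed
  finally show ?thesis by simp
qed

text \<open>The left side vanishes unless \<open>x > \<epsilon>\<close>, and there
  \<open>x powr (p - q) \<le> \<epsilon> powr (p - q)\<close> because the exponent is not
  positive.\<close>

lemma pos_part_diff_powr_le:
  fixes p q x \<epsilon> :: real
  assumes "0 < p" "p \<le> q" "0 < \<epsilon>" "0 \<le> x"
  shows "pos_part (x - \<epsilon>) powr p \<le> \<epsilon> powr (p - q) * x powr q"
proof (cases "\<epsilon> < x")
  case True
  have "pos_part (x - \<epsilon>) powr p \<le> x powr p"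
    using True assms by (intro powr_mono2) (auto simp: pos_part_def)
  also have "\<dots> = x powr (p - q) * x powr q" using True assms by (simp add: powr_diff)
  also have "\<dots> \<le> \<epsilon> powr (p - q) * x powr q"
    using True assms by (intro mult_right_mono powr_mono2') auto
  finally show ?thesis .
qed (use assms in \<open>simp add: pos_part_def max_absorb2\<close>)

text \<open>Splits a p-th power at level 3. Above that level the right side is exactly
  \<open>(y / b) powr p\<close>; with \<open>y = \<bar>S \<omega>\<bar>\<close> its last term
  measures how far \<open>\<bar>S \<omega>\<bar> / 3\<close> exceeds \<open>b\<close>.\<close>

lemma powr_le_min_powr_add:
  fixes p f y b :: real
  assumes "0 < p" "0 < b" "0 \<le> f" "f \<le> y / b"
  shows "f powr p \<le> min f 3 powr p + 3 powr p * b powr (- p) * max ((y / 3) powr p - b powr p) 0"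
proof (cases "f \<le> 3")
  case False
  have y: "0 < y" using False assms by (auto simp: field_simps) (smt (verit) mult_pos_pos)
  have "f powr p \<le> (y / b) powr p" using assms by (intro powr_mono2) auto
  also have "\<dots> = 3 powr p + 3 powr p * b powr (- p) * ((y / 3) powr p - b powr p)"
    using y assms by (simp add: powr_divide powr_minus field_simps)
  also have "\<dots> \<le> min f 3 powr p + 3 powr p * b powr (- p) * max ((y / 3) powr p - b powr p) 0"
    using False by (intro add_mono mult_left_mono) auto
  finally show ?thesis .
qed simp

section \<open>The estimate for one row of the array\<close>

text \<open>In the application \<open>I\<close> is \<open>{1..n}\<close>, and \<alpha> and
  \<open>b\<close> are the n-th terms of their sequences. The weight \<open>c n\<close> only
  multiplies the final bound of the row and stays outside.\<close>

locale truncated_moments = prob_space M for M :: "'a measure" +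
  fixes I :: "'i set" and X :: "'i \<Rightarrow> 'a \<Rightarrow> real" and p q \<alpha> b :: real
  assumes finite_I: "finite I"
    and X_measurable: "\<And>k. k \<in> I \<Longrightarrow> X k \<in> borel_measurable M"
    and X_powr_integrable: "\<And>k. k \<in> I \<Longrightarrow> integrable M (\<lambda>\<omega>. \<bar>X k \<omega>\<bar> powr p)"
    and p_gt: "1 < p" and q_gt: "p < q" and \<alpha>_pos: "0 < \<alpha>" and b_pos: "0 < b"
    and moment: "\<And>t. t > 0 \<Longrightarrow>
      (\<integral>\<omega>. \<bar>\<Sum>k\<in>I. trunc t (X k \<omega>) - (\<integral>\<omega>'. trunc t (X k \<omega>') \<partial>M)\<bar> powr q \<partial>M)
        \<le> \<alpha> * (\<Sum>k\<in>I. \<integral>\<omega>. \<bar>trunc t (X k \<omega>)\<bar> powr q \<partial>M)"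
begin

definition S :: "'a \<Rightarrow> real" where
  "S \<omega> = (\<Sum>k\<in>I. X k \<omega> - expectation (X k))"

definition T :: "real \<Rightarrow> 'a \<Rightarrow> real" where
  "T t \<omega> = (\<Sum>k\<in>I. trunc t (X k \<omega>) - expectation (\<lambda>\<omega>'. trunc t (X k \<omega>')))"

text \<open>Through the tail integrals, \<open>D k\<close> is the integral in (c) and
  \<open>A b k\<close> the one in (a), while \<open>R b k\<close> is at most the expectation in (b).
  \<open>A\<close> and \<open>R\<close> take a free level because the part above level 3 uses them
  at every \<open>s > b\<close>.\<close>

definition D :: "'i \<Rightarrow> real" where
  "D k = expectation (\<lambda>\<omega>. max (\<bar>X k \<omega>\<bar> powr p - b powr p) 0)"

definition A :: "real \<Rightarrow> 'i \<Rightarrow> real" where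
  "A t k = expectation (\<lambda>\<omega>. min \<bar>X k \<omega>\<bar> t powr q)"

definition R :: "real \<Rightarrow> 'i \<Rightarrow> real" where
  "R t k = expectation (\<lambda>\<omega>. max (\<bar>X k \<omega>\<bar> - t) 0)"

lemmas [measurable] = X_measurable

lemma S_measurable [measurable]: "S \<in> borel_measurable M"
  unfolding S_def by measurable

lemma T_measurable [measurable]: "T t \<in> borel_measurable M"
  unfolding T_def by measurable

lemma X_integrable:
  assumes k: "k \<in> I"
  shows "integrable M (X k)"
proof (rule Bochner_Integration.integrable_bound)
  show "integrable M (\<lambda>\<omega>. 1 + \<bar>X k \<omega>\<bar> powr p)"
    using X_powr_integrable[OF k] by simp
  have "\<bar>x\<bar> \<le> 1 + \<bar>x\<bar> powr p" for x :: real
  proof (cases "\<bar>x\<bar> \<le> 1")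
    case False
    then have "\<bar>x\<bar> powr 1 \<le> \<bar>x\<bar> powr p"
      using p_gt by (intro powr_mono) auto
    with False show ?thesis by simp
  qed (simp add: add_increasing2)
  then show "AE \<omega> in M. norm (X k \<omega>) \<le> norm (1 + \<bar>X k \<omega>\<bar> powr p)"
    by simp
qed (use k in measurable)

lemma trunc_integrable:
  assumes k: "k \<in> I"
  shows "integrable M (\<lambda>\<omega>. trunc t (X k \<omega>))"
  by (rule integrable_const_bound[where B = "\<bar>t\<bar>"]) (use k in \<open>auto simp: trunc_def\<close>)

lemma D_integrable:
  assumes k: "k \<in> I"
  shows "integrable M (\<lambda>\<omega>. max (\<bar>X k \<omega>\<bar> powr p - b powr p) 0)"
  by (rule Bochner_Integration.integrable_bound[OF X_powr_integrable[OF k]]) (use k in auto)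

lemma A_integrable:
  assumes k: "k \<in> I" and "0 < t"
  shows "integrable M (\<lambda>\<omega>. min \<bar>X k \<omega>\<bar> t powr q)"
  using k assms(2) p_gt q_gt
  by (intro integrable_const_bound[where B = "t powr q"]) (auto intro!: powr_mono2)

lemma R_integrable:
  assumes k: "k \<in> I" and "0 < t"
  shows "integrable M (\<lambda>\<omega>. max (\<bar>X k \<omega>\<bar> - t) 0)"
  by (rule Bochner_Integration.integrable_bound[OF X_integrable[OF k]]) (use assms in auto)

lemma D_nonneg: "0 \<le> D k" and A_nonneg: "0 \<le> A t k" and R_nonneg: "0 \<le> R t k"
  unfolding D_def A_def R_def by (auto intro!: integral_nonneg)

section \<open>Bounds for the centred sum at a fixed truncation level\<close>

lemma S_le:
  assumes "0 < t"
  shows "\<bar>S \<omega>\<bar> \<le> \<bar>T t \<omega>\<bar> + (\<Sum>k\<in>I. max (\<bar>X k \<omega>\<bar> - t) 0) + (\<Sum>k\<in>I. R t k)"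
proof -
  let ?Y = "\<lambda>k \<omega>. X k \<omega> - trunc t (X k \<omega>)"
  have "S \<omega> = T t \<omega> + (\<Sum>k\<in>I. ?Y k \<omega>) - (\<Sum>k\<in>I. expectation (?Y k))"
    unfolding S_def T_def
    by (simp add: X_integrable trunc_integrable sum_subtractf)
  moreover have "\<bar>\<Sum>k\<in>I. ?Y k \<omega>\<bar> \<le> (\<Sum>k\<in>I. max (\<bar>X k \<omega>\<bar> - t) 0)"
    by (rule order_trans[OF sum_abs]) (simp add: abs_diff_trunc[OF assms])
  moreover have "\<bar>\<Sum>k\<in>I. expectation (?Y k)\<bar> \<le> (\<Sum>k\<in>I. R t k)"
    unfolding R_def abs_diff_trunc[OF assms, symmetric]
    by (rule order_trans[OF sum_abs]) (intro sum_mono integral_abs_bound)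
  ultimately show ?thesis by linarith
qed

text \<open>Integrability is proved separately, from the boundedness of \<open>T t\<close>: a
  Bochner integral defaults to 0 on non-integrable functions, so the moment bound alone would not
  support Markov's inequality.\<close>

lemma T_moment:
  assumes "0 < t"
  shows "integrable M (\<lambda>\<omega>. \<bar>T t \<omega>\<bar> powr q)"
    and "expectation (\<lambda>\<omega>. \<bar>T t \<omega>\<bar> powr q) \<le> \<alpha> * (\<Sum>k\<in>I. A t k)"
proof -
  have "\<bar>T t \<omega>\<bar> \<le> (\<Sum>k\<in>I. t + \<bar>expectation (\<lambda>\<omega>'. trunc t (X k \<omega>'))\<bar>)" for \<omega>
    unfolding T_def
  proof (rule order_trans[OF sum_abs sum_mono])
    fix k
    have "\<bar>trunc t (X k \<omega>)\<bar> \<le> t" using abs_trunc[OF assms] by simp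
    then show "\<bar>trunc t (X k \<omega>) - expectation (\<lambda>\<omega>'. trunc t (X k \<omega>'))\<bar>
      \<le> t + \<bar>expectation (\<lambda>\<omega>'. trunc t (X k \<omega>'))\<bar>" by linarith
  qed
  then show "integrable M (\<lambda>\<omega>. \<bar>T t \<omega>\<bar> powr q)"
    using p_gt q_gt
    by (intro integrable_const_bound[where B = "(\<Sum>k\<in>I. t + \<bar>expectation (\<lambda>\<omega>'. trunc t (X k \<omega>'))\<bar>) powr q"])
      (auto intro!: powr_mono2)
  show "expectation (\<lambda>\<omega>. \<bar>T t \<omega>\<bar> powr q) \<le> \<alpha> * (\<Sum>k\<in>I. A t k)"
    using moment[OF assms] unfolding T_def A_def abs_trunc[OF assms] .
qed

text \<open>Multiplied by \<open>s powr (p - 1)\<close>, the mean excesses sum to at most the sum of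
  the \<open>D k\<close>, which by assumption is at most \<open>s powr p\<close>; dividing by
  \<open>s powr (p - 1)\<close> gives the claim.\<close>

lemma R_sum_le:
  assumes "b < s" "(\<Sum>k\<in>I. D k) powr (1 / p) \<le> s"
  shows "(\<Sum>k\<in>I. R s k) \<le> s"
proof -
  have s: "0 < s" using assms b_pos by simp
  have "s powr (p - 1) * R s k \<le> D k" if k: "k \<in> I" for k
  proof -
    have "s powr (p - 1) * max (x - s) 0 \<le> max (x powr p - b powr p) 0" if "0 \<le> x" for x
    proof -
      have "b powr p \<le> s powr p" using assms b_pos p_gt by (intro powr_mono2) auto
      with powr_sub_diff_le[of p s x] show ?thesis using p_gt s that by simp
    qed
    then have "expectation (\<lambda>\<omega>. s powr (p - 1) * max (\<bar>X k \<omega>\<bar> - s) 0) \<le> D k"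
      unfolding D_def using R_integrable[OF k s] D_integrable[OF k]
      by (intro integral_mono) auto
    then show ?thesis unfolding R_def by simp
  qed
  then have "s powr (p - 1) * (\<Sum>k\<in>I. R s k) \<le> (\<Sum>k\<in>I. D k)"
    by (simp add: sum_distrib_left sum_mono)
  also have "(\<Sum>k\<in>I. D k) = ((\<Sum>k\<in>I. D k) powr (1 / p)) powr p"
    using p_gt D_nonneg by (simp add: powr_powr sum_nonneg)
  also have "\<dots> \<le> s powr p"
    using assms p_gt by (intro powr_mono2) auto
  also have "s powr p = s powr (p - 1) * s" using s by (simp add: powr_diff)
  finally show ?thesis using s by simp
qed

text \<open>The three terms come from Markov's inequality for \<open>T s\<close>, from a union bound
  over the events \<open>\<bar>X k\<bar> > s\<close>, and from the trivial bound 1 at levels too low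
  for \<open>R_sum_le\<close>.\<close>

lemma prob_S_le:
  assumes "b < s"
  shows "\<P>(\<omega> in M. \<bar>S \<omega>\<bar> / 3 > s) \<le> \<alpha> * (\<Sum>k\<in>I. s powr (- q) * A s k)
    + (\<Sum>k\<in>I. \<P>(\<omega> in M. \<bar>X k \<omega>\<bar> > s)) + indicator {..<(\<Sum>k\<in>I. D k) powr (1 / p)} s"
proof (cases "s < (\<Sum>k\<in>I. D k) powr (1 / p)")
  case True
  have "0 \<le> \<alpha> * (\<Sum>k\<in>I. s powr (- q) * A s k)"
    using \<alpha>_pos A_nonneg by (intro mult_nonneg_nonneg sum_nonneg) auto
  moreover have "0 \<le> (\<Sum>k\<in>I. \<P>(\<omega> in M. \<bar>X k \<omega>\<bar> > s))"
    by (intro sum_nonneg) auto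
  ultimately show ?thesis using True
    by (simp add: add_increasing)
next
  case False
  have s: "0 < s" using assms b_pos by simp
  \<comment> \<open>Off the union all excesses vanish, and the mean excesses cost at most
    \<open>s\<close>. Hence \<open>\<bar>S \<omega>\<bar> > 3 * s\<close> leaves
    \<open>\<bar>T s \<omega>\<bar> > 2 * s\<close>, more than the \<open>s\<close> used
    here.\<close>
  have sub: "{\<omega>\<in>space M. \<bar>S \<omega>\<bar> / 3 > s}
    \<subseteq> {\<omega>\<in>space M. \<bar>T s \<omega>\<bar> powr q \<ge> s powr q} \<union> (\<Union>k\<in>I. {\<omega>\<in>space M. \<bar>X k \<omega>\<bar> > s})"
  proof (intro subsetI UnCI)
    fix \<omega> assume \<omega>: "\<omega> \<in> {\<omega>\<in>space M. \<bar>S \<omega>\<bar> / 3 > s}" "\<omega> \<notin> (\<Union>k\<in>I. {\<omega>\<in>space M. \<bar>X k \<omega>\<bar> > s})"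
    then have "(\<Sum>k\<in>I. max (\<bar>X k \<omega>\<bar> - s) 0) = 0"
      by (intro sum.neutral) fastforce
    then have "s \<le> \<bar>T s \<omega>\<bar>"
      using S_le[OF s, of \<omega>] R_sum_le[OF assms] False \<omega>(1) s by simp
    then show "\<omega> \<in> {\<omega>\<in>space M. \<bar>T s \<omega>\<bar> powr q \<ge> s powr q}"
      using \<omega>(1) s p_gt q_gt by (auto intro!: powr_mono2)
  qed
  have sets: "{\<omega>\<in>space M. \<bar>T s \<omega>\<bar> powr q \<ge> s powr q} \<in> events"
    "(\<Union>k\<in>I. {\<omega>\<in>space M. \<bar>X k \<omega>\<bar> > s}) \<in> events"
    using finite_I by auto
  have "\<P>(\<omega> in M. \<bar>S \<omega>\<bar> / 3 > s)
    \<le> prob ({\<omega>\<in>space M. \<bar>T s \<omega>\<bar> powr q \<ge> s powr q} \<union> (\<Union>k\<in>I. {\<omega>\<in>space M. \<bar>X k \<omega>\<bar> > s}))"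
    by (rule finite_measure_mono[OF sub sets.Un[OF sets]])
  also have "\<dots> \<le> \<P>(\<omega> in M. \<bar>T s \<omega>\<bar> powr q \<ge> s powr q) + prob (\<Union>k\<in>I. {\<omega>\<in>space M. \<bar>X k \<omega>\<bar> > s})"
    by (rule measure_Un_le[OF sets])
  also have "\<P>(\<omega> in M. \<bar>T s \<omega>\<bar> powr q \<ge> s powr q) \<le> expectation (\<lambda>\<omega>. \<bar>T s \<omega>\<bar> powr q) / s powr q"
    using T_moment(1)[OF s] s by (intro integral_Markov_inequality_measure[where A = "space M"]) auto
  also have "expectation (\<lambda>\<omega>. \<bar>T s \<omega>\<bar> powr q) / s powr q \<le> \<alpha> * (\<Sum>k\<in>I. A s k) / s powr q"
    using T_moment(2)[OF s] by (intro divide_right_mono) auto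
  also have "\<dots> = \<alpha> * (\<Sum>k\<in>I. s powr (- q) * A s k)"
    by (simp add: powr_minus_divide flip: sum_divide_distrib)
  also have "prob (\<Union>k\<in>I. {\<omega>\<in>space M. \<bar>X k \<omega>\<bar> > s}) \<le> (\<Sum>k\<in>I. \<P>(\<omega> in M. \<bar>X k \<omega>\<bar> > s))"
    using finite_I by (intro measure_UNION_le) auto
  finally show ?thesis by (simp add: indicator_def)
qed

section \<open>The part above level 3\<close>

text \<open>Integrates \<open>prob_S_le\<close> against the layer-cake density over
  \<open>s > b\<close>. The sum of the \<open>D k\<close> appears twice at the end: once from the
  tails of the \<open>X k\<close>, once from the low levels covered by the indicator.\<close>

lemma nn_integral_S_tail:
  "(\<integral>\<^sup>+\<omega>. ennreal (max ((\<bar>S \<omega>\<bar> / 3) powr p - b powr p) 0) \<partial>M)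
    \<le> ennreal (\<alpha> * (\<Sum>k\<in>I. (1 + p / (q - p)) * D k + p / (q - p) * (b powr (p - q) * A b k))
      + 2 * (\<Sum>k\<in>I. D k))"
proof -
  interpret pair_sigma_finite M lborel ..
  define V where "V = (\<Sum>k\<in>I. D k)"
  define w :: "real \<Rightarrow> ennreal" where "w s = ennreal (p * s powr (p - 1)) * indicator {b<..} s" for s
  \<comment> \<open>\<open>A s k\<close> depends on \<open>s\<close> through an expectation.
    Expressing it by the jointly measurable \<open>g\<close> gives measurability in \<open>s\<close>
    and allows the order of integration to be exchanged.\<close>
  define g where "g k \<omega> s = ennreal (s powr (- q) * min \<bar>X k \<omega>\<bar> s powr q)" for k \<omega> s
  have [measurable]: "w \<in> borel_measurable borel" unfolding w_def by measurable
  have [measurable]: "(\<lambda>(\<omega>, s). g k \<omega> s) \<in> borel_measurable (M \<Otimes>\<^sub>M lborel)" if [measurable]: "k \<in> I" for k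
    unfolding g_def by measurable
  have [measurable]: "(\<lambda>s. \<integral>\<^sup>+\<omega>. g k \<omega> s \<partial>M) \<in> borel_measurable borel" if [measurable]: "k \<in> I" for k
    unfolding g_def by measurable
  have [measurable]: "(\<lambda>s. ennreal \<P>(\<omega> in M. \<bar>X k \<omega>\<bar> > s)) \<in> borel_measurable borel" if [measurable]: "k \<in> I" for k
    by (rule borel_measurable_tail) measurable
  have V: "0 \<le> V" unfolding V_def by (intro sum_nonneg D_nonneg)
  have w_Ioo: "(\<integral>\<^sup>+s. w s * indicator {..<y} s \<partial>lborel) = ennreal (max (y powr p - b powr p) 0)" if "0 \<le> y" for y
    unfolding w_def using that b_pos p_gt by (intro nn_integral_powr_Ioo) auto
  have D_eq: "(\<integral>\<^sup>+\<omega>. ennreal (max (\<bar>X k \<omega>\<bar> powr p - b powr p) 0) \<partial>M) = ennreal (D k)" if "k \<in> I" for k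
    unfolding D_def using D_integrable[OF that] by (intro nn_integral_eq_integral) auto
  have A_eq: "ennreal (s powr (- q) * A s k) = (\<integral>\<^sup>+\<omega>. g k \<omega> s \<partial>M)" if "k \<in> I" "0 < s" for k s
  proof -
    have "s powr (- q) * A s k = expectation (\<lambda>\<omega>. s powr (- q) * min \<bar>X k \<omega>\<bar> s powr q)"
      by (simp add: A_def)
    then show ?thesis unfolding g_def
      using A_integrable[OF that] by (simp only:) (intro nn_integral_eq_integral[symmetric], auto)
  qed
  have le: "w s * ennreal \<P>(\<omega> in M. \<bar>S \<omega>\<bar> / 3 > s) \<le> ennreal \<alpha> * (\<Sum>k\<in>I. w s * (\<integral>\<^sup>+\<omega>. g k \<omega> s \<partial>M))
    + (\<Sum>k\<in>I. w s * ennreal \<P>(\<omega> in M. \<bar>X k \<omega>\<bar> > s)) + w s * indicator {..<V powr (1 / p)} s" for s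
  proof (cases "b < s")
    case True
    then have s: "0 < s" using b_pos by simp
    have "ennreal \<P>(\<omega> in M. \<bar>S \<omega>\<bar> / 3 > s) \<le> ennreal (\<alpha> * (\<Sum>k\<in>I. s powr (- q) * A s k)
      + (\<Sum>k\<in>I. \<P>(\<omega> in M. \<bar>X k \<omega>\<bar> > s)) + indicator {..<V powr (1 / p)} s)"
      unfolding V_def by (rule ennreal_leI[OF prob_S_le[OF True]])
    also have "\<dots> = ennreal \<alpha> * (\<Sum>k\<in>I. ennreal (s powr (- q) * A s k))
      + (\<Sum>k\<in>I. ennreal \<P>(\<omega> in M. \<bar>X k \<omega>\<bar> > s)) + indicator {..<V powr (1 / p)} s"
      using \<alpha>_pos A_nonneg
      by (simp add: ennreal_plus ennreal_mult[OF less_imp_le[OF \<alpha>_pos]] sum_nonneg ennreal_indicator)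
    also have "(\<Sum>k\<in>I. ennreal (s powr (- q) * A s k)) = (\<Sum>k\<in>I. \<integral>\<^sup>+\<omega>. g k \<omega> s \<partial>M)"
      using A_eq s by (intro sum.cong) auto
    finally have "w s * ennreal \<P>(\<omega> in M. \<bar>S \<omega>\<bar> / 3 > s) \<le> w s * (ennreal \<alpha> * (\<Sum>k\<in>I. \<integral>\<^sup>+\<omega>. g k \<omega> s \<partial>M)
      + (\<Sum>k\<in>I. ennreal \<P>(\<omega> in M. \<bar>X k \<omega>\<bar> > s)) + indicator {..<V powr (1 / p)} s)"
      by (intro mult_left_mono) auto
    then show ?thesis
      by (simp add: distrib_left sum_distrib_left mult.left_commute del: sum_ennreal)
  qed (simp add: w_def)
  have "(\<integral>\<^sup>+\<omega>. ennreal (max ((\<bar>S \<omega>\<bar> / 3) powr p - b powr p) 0) \<partial>M)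
    = (\<integral>\<^sup>+s. w s * ennreal \<P>(\<omega> in M. \<bar>S \<omega>\<bar> / 3 > s) \<partial>lborel)"
    by (subst nn_integral_weighted_tail) (auto simp: w_Ioo)
  also have "\<dots> \<le> (\<integral>\<^sup>+s. ennreal \<alpha> * (\<Sum>k\<in>I. w s * (\<integral>\<^sup>+\<omega>. g k \<omega> s \<partial>M))
    + (\<Sum>k\<in>I. w s * ennreal \<P>(\<omega> in M. \<bar>X k \<omega>\<bar> > s)) + w s * indicator {..<V powr (1 / p)} s \<partial>lborel)"
    by (intro nn_integral_mono le)
  also have "\<dots> = ennreal \<alpha> * (\<Sum>k\<in>I. \<integral>\<^sup>+s. w s * (\<integral>\<^sup>+\<omega>. g k \<omega> s \<partial>M) \<partial>lborel)
    + (\<Sum>k\<in>I. \<integral>\<^sup>+s. w s * ennreal \<P>(\<omega> in M. \<bar>X k \<omega>\<bar> > s) \<partial>lborel)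
    + (\<integral>\<^sup>+s. w s * indicator {..<V powr (1 / p)} s \<partial>lborel)"
    by (simp add: nn_integral_add nn_integral_cmult nn_integral_sum)
  also have "\<dots> \<le> ennreal \<alpha> * (\<Sum>k\<in>I. ennreal ((1 + p / (q - p)) * D k + p / (q - p) * (b powr (p - q) * A b k)))
    + (\<Sum>k\<in>I. ennreal (D k)) + ennreal V"
  proof (intro add_mono mult_left_mono sum_mono)
    fix k assume k: "k \<in> I"
    note [measurable] = k
    have "(\<integral>\<^sup>+s. w s * (\<integral>\<^sup>+\<omega>. g k \<omega> s \<partial>M) \<partial>lborel) = (\<integral>\<^sup>+s. (\<integral>\<^sup>+\<omega>. w s * g k \<omega> s \<partial>M) \<partial>lborel)"
      unfolding g_def by (intro nn_integral_cong nn_integral_cmult[symmetric]) measurable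
    also have "\<dots> = (\<integral>\<^sup>+\<omega>. (\<integral>\<^sup>+s. w s * g k \<omega> s \<partial>lborel) \<partial>M)"
      by (rule Fubini') measurable
    also have "\<dots> \<le> (\<integral>\<^sup>+\<omega>. ennreal ((1 + p / (q - p)) * max (\<bar>X k \<omega>\<bar> powr p - b powr p) 0
      + p / (q - p) * (b powr (p - q) * min \<bar>X k \<omega>\<bar> b powr q)) \<partial>M)"
      unfolding w_def g_def using p_gt q_gt b_pos
      by (intro nn_integral_mono nn_integral_min_powr_le) auto
    also have "\<dots> = ennreal (expectation (\<lambda>\<omega>. (1 + p / (q - p)) * max (\<bar>X k \<omega>\<bar> powr p - b powr p) 0
      + p / (q - p) * (b powr (p - q) * min \<bar>X k \<omega>\<bar> b powr q)))"
      using D_integrable[OF k] A_integrable[OF k b_pos] p_gt q_gt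
      by (intro nn_integral_eq_integral) auto
    also have "expectation (\<lambda>\<omega>. (1 + p / (q - p)) * max (\<bar>X k \<omega>\<bar> powr p - b powr p) 0
      + p / (q - p) * (b powr (p - q) * min \<bar>X k \<omega>\<bar> b powr q))
      = (1 + p / (q - p)) * D k + p / (q - p) * (b powr (p - q) * A b k)"
      unfolding D_def A_def using D_integrable[OF k] A_integrable[OF k b_pos]
      by (subst Bochner_Integration.integral_add) auto
    finally show "(\<integral>\<^sup>+s. w s * (\<integral>\<^sup>+\<omega>. g k \<omega> s \<partial>M) \<partial>lborel)
      \<le> ennreal ((1 + p / (q - p)) * D k + p / (q - p) * (b powr (p - q) * A b k))" .
  next
    fix k assume k: "k \<in> I"
    show "(\<integral>\<^sup>+s. w s * ennreal \<P>(\<omega> in M. \<bar>X k \<omega>\<bar> > s) \<partial>lborel) \<le> ennreal (D k)"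
      using k by (subst nn_integral_weighted_tail) (auto simp: w_Ioo D_eq simp del: ennreal_max_0 ennreal_max_0')
  next
    \<comment> \<open>The low levels integrate to the positive part of \<open>V - b powr p\<close>,
      hence to at most \<open>V\<close>.\<close>
    have "(V powr (1 / p)) powr p = V" using V p_gt by (simp add: powr_powr)
    then show "(\<integral>\<^sup>+s. w s * indicator {..<V powr (1 / p)} s \<partial>lborel) \<le> ennreal V"
      using V by (subst w_Ioo) (auto intro!: ennreal_leI)
  qed auto
  also have "\<dots> = ennreal (\<alpha> * (\<Sum>k\<in>I. (1 + p / (q - p)) * D k + p / (q - p) * (b powr (p - q) * A b k)) + 2 * V)"
    using V \<alpha>_pos p_gt q_gt D_nonneg A_nonneg
    by (simp add: ennreal_plus[symmetric] ennreal_mult[symmetric] sum_nonneg flip: V_def del: ennreal_plus)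
  finally show ?thesis unfolding V_def .
qed

section \<open>The part below level 3 and the combined bound\<close>

definition F :: "real \<Rightarrow> 'a \<Rightarrow> real" where
  "F \<epsilon> \<omega> = pos_part (\<bar>S \<omega>\<bar> / b - \<epsilon>)"

lemma F_nonneg: "0 \<le> F \<epsilon> \<omega>"
  by (simp add: F_def pos_part_def)

lemma F_measurable [measurable]: "F \<epsilon> \<in> borel_measurable M"
  unfolding F_def pos_part_def by measurable

text \<open>Only the truncation level \<open>b\<close> is used. The excess sum and its mean have the
  same expectation, which explains the factor 2.\<close>

lemma nn_integral_min_F:
  assumes "0 < \<epsilon>"
  shows "(\<integral>\<^sup>+\<omega>. ennreal (min (F \<epsilon> \<omega>) 3 powr p) \<partial>M)
    \<le> ennreal (3 powr p * (\<epsilon> powr (p - q) * b powr (- q) * \<alpha> * (\<Sum>k\<in>I. A b k) + 2 * (\<Sum>k\<in>I. R b k) / b))"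
proof -
  define Y where "Y \<omega> = (\<Sum>k\<in>I. max (\<bar>X k \<omega>\<bar> - b) 0)" for \<omega>
  define m where "m = (\<Sum>k\<in>I. R b k)"
  have Y: "integrable M Y" "expectation Y = m"
    unfolding Y_def m_def R_def using R_integrable b_pos by auto
  have nonneg: "0 \<le> Y \<omega>" "0 \<le> m" for \<omega>
    unfolding Y_def m_def using R_nonneg by (auto intro!: sum_nonneg)
  have "min (F \<epsilon> \<omega>) 3 powr p
    \<le> 3 powr p * (\<epsilon> powr (p - q) * b powr (- q) * \<bar>T b \<omega>\<bar> powr q + Y \<omega> / b + m / b)" for \<omega>
  proof -
    have "\<bar>S \<omega>\<bar> / b \<le> (\<bar>T b \<omega>\<bar> + Y \<omega> + m) / b"
      using S_le[OF b_pos, of \<omega>] b_pos unfolding Y_def m_def by (intro divide_right_mono) auto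
    \<comment> \<open>The whole of \<epsilon> is charged to the truncated sum, the only term where a
      p-th power must be traded for a q-th power.\<close>
    then have "F \<epsilon> \<omega> \<le> pos_part (\<bar>T b \<omega>\<bar> / b - \<epsilon>) + Y \<omega> / b + m / b"
      using nonneg(1)[of \<omega>] nonneg(2) b_pos by (simp add: F_def pos_part_def add_divide_distrib)
    then have "min (F \<epsilon> \<omega>) 3 powr p
      \<le> 3 powr p * (pos_part (\<bar>T b \<omega>\<bar> / b - \<epsilon>) powr p + Y \<omega> / b + m / b)"
      using nonneg b_pos p_gt F_nonneg by (intro min_powr_add3_le) (auto simp: pos_part_def)
    also have "pos_part (\<bar>T b \<omega>\<bar> / b - \<epsilon>) powr p \<le> \<epsilon> powr (p - q) * (\<bar>T b \<omega>\<bar> / b) powr q"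
      using assms b_pos p_gt q_gt by (intro pos_part_diff_powr_le) auto
    also have "\<dots> = \<epsilon> powr (p - q) * b powr (- q) * \<bar>T b \<omega>\<bar> powr q"
      using b_pos by (simp add: powr_divide powr_minus field_simps)
    finally show ?thesis by simp
  qed
  then have "(\<integral>\<^sup>+\<omega>. ennreal (min (F \<epsilon> \<omega>) 3 powr p) \<partial>M)
    \<le> (\<integral>\<^sup>+\<omega>. ennreal (3 powr p * (\<epsilon> powr (p - q) * b powr (- q) * \<bar>T b \<omega>\<bar> powr q + Y \<omega> / b + m / b)) \<partial>M)"
    by (intro nn_integral_mono ennreal_leI)
  also have "\<dots> = ennreal (expectation
    (\<lambda>\<omega>. 3 powr p * (\<epsilon> powr (p - q) * b powr (- q) * \<bar>T b \<omega>\<bar> powr q + Y \<omega> / b + m / b)))"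
    using T_moment(1)[OF b_pos] Y nonneg b_pos by (intro nn_integral_eq_integral) auto
  also have "\<dots> = ennreal (3 powr p *
    (\<epsilon> powr (p - q) * b powr (- q) * expectation (\<lambda>\<omega>. \<bar>T b \<omega>\<bar> powr q) + m / b + m / b))"
    using T_moment(1)[OF b_pos] Y by (simp add: prob_space)
  also have "\<dots> \<le> ennreal (3 powr p *
    (\<epsilon> powr (p - q) * b powr (- q) * (\<alpha> * (\<Sum>k\<in>I. A b k)) + m / b + m / b))"
    using T_moment(2)[OF b_pos] by (intro ennreal_leI mult_left_mono add_mono) auto
  finally show ?thesis by (simp add: m_def mult.assoc add.commute)
qed

text \<open>With \<open>r = p / (q - p)\<close> and \<open>e = \<epsilon> powr (p - q)\<close>, the
  sums of \<open>A\<close>, \<open>R\<close> and \<open>D\<close>, suitably normalised, get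
  coefficients \<open>e + r\<close>, 2 and \<open>\<alpha> * (1 + r) + 2\<close>. All are covered by
  \<open>e + r + 2\<close>, the last with the extra factor \<open>1 + \<alpha>\<close> that (c)
  supplies.\<close>

lemma nn_integral_F_powr:
  assumes "0 < \<epsilon>"
  shows "(\<integral>\<^sup>+\<omega>. ennreal (F \<epsilon> \<omega> powr p) \<partial>M)
    \<le> ennreal (3 powr p * (\<epsilon> powr (p - q) + p / (q - p) + 2) *
      (\<Sum>k\<in>I. \<alpha> * b powr (- q) * A b k + R b k / b + (1 + \<alpha>) * b powr (- p) * D k))"
proof -
  define r e SA SR SD where "r = p / (q - p)" and "e = \<epsilon> powr (p - q)"
    and "SA = (\<Sum>k\<in>I. A b k)" and "SR = (\<Sum>k\<in>I. R b k)" and "SD = (\<Sum>k\<in>I. D k)"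
  have nonneg: "0 \<le> r" "0 \<le> e" "0 \<le> SA" "0 \<le> SR" "0 \<le> SD"
    unfolding r_def e_def SA_def SR_def SD_def using p_gt q_gt A_nonneg R_nonneg D_nonneg
    by (auto intro!: sum_nonneg)
  have "F \<epsilon> \<omega> powr p \<le> min (F \<epsilon> \<omega>) 3 powr p
    + 3 powr p * b powr (- p) * max ((\<bar>S \<omega>\<bar> / 3) powr p - b powr p) 0" for \<omega>
    using p_gt b_pos F_nonneg assms
    by (intro powr_le_min_powr_add) (auto simp: F_def pos_part_def)
  then have "(\<integral>\<^sup>+\<omega>. ennreal (F \<epsilon> \<omega> powr p) \<partial>M) \<le> (\<integral>\<^sup>+\<omega>. ennreal (min (F \<epsilon> \<omega>) 3 powr p
    + 3 powr p * b powr (- p) * max ((\<bar>S \<omega>\<bar> / 3) powr p - b powr p) 0) \<partial>M)"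
    by (intro nn_integral_mono ennreal_leI)
  also have "\<dots> = (\<integral>\<^sup>+\<omega>. ennreal (min (F \<epsilon> \<omega>) 3 powr p) \<partial>M)
    + ennreal (3 powr p * b powr (- p)) * (\<integral>\<^sup>+\<omega>. ennreal (max ((\<bar>S \<omega>\<bar> / 3) powr p - b powr p) 0) \<partial>M)"
    by (simp add: nn_integral_add nn_integral_cmult ennreal_plus ennreal_mult del: ennreal_max_0 ennreal_max_0')
  also have "\<dots> \<le> ennreal (3 powr p * (e * b powr (- q) * \<alpha> * SA + 2 * SR / b))
    + ennreal (3 powr p * b powr (- p)) *
      ennreal (\<alpha> * ((1 + r) * SD + r * (b powr (p - q) * SA)) + 2 * SD)"
    using nn_integral_min_F[OF assms] nn_integral_S_tail
    unfolding r_def e_def SA_def SR_def SD_def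
    by (intro add_mono mult_left_mono) (simp_all add: sum.distrib sum_distrib_left)
  also have "\<dots> = ennreal (3 powr p * (e * b powr (- q) * \<alpha> * SA + 2 * SR / b)
    + 3 powr p * b powr (- p) * (\<alpha> * ((1 + r) * SD + r * (b powr (p - q) * SA)) + 2 * SD))"
    using nonneg \<alpha>_pos b_pos by (simp flip: ennreal_plus ennreal_mult)
  also have "\<dots> \<le> ennreal (3 powr p * (e + r + 2) *
    (\<alpha> * b powr (- q) * SA + SR / b + (1 + \<alpha>) * b powr (- p) * SD))"
  proof (rule ennreal_leI)
    \<comment> \<open>This identity gives the \<open>A\<close> terms from above and below level 3
      the same normalisation.\<close>
    have b: "b powr (- p) * b powr (p - q) = b powr (- q)"
      by (simp flip: powr_add)
    define P where "P = b powr (- p)"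
    define Q where "Q = b powr (- q)"
    have nn: "0 \<le> P" "0 \<le> Q" "0 \<le> SR / b" using nonneg b_pos by (auto simp: P_def Q_def)
    have "P * (\<alpha> * ((1 + r) * SD + r * (b powr (p - q) * SA)) + 2 * SD)
      = P * (\<alpha> * (1 + r) + 2) * SD + r * \<alpha> * Q * SA"
      unfolding P_def Q_def b[symmetric] by (simp add: algebra_simps)
    then have "e * Q * \<alpha> * SA + 2 * SR / b + P * (\<alpha> * ((1 + r) * SD + r * (b powr (p - q) * SA)) + 2 * SD)
      = (e + r) * (\<alpha> * Q * SA) + 2 * (SR / b) + (\<alpha> * (1 + r) + 2) * (P * SD)"
      by (simp add: algebra_simps)
    also have "\<dots> \<le> (e + r + 2) * (\<alpha> * Q * SA) + (e + r + 2) * (SR / b) + ((e + r + 2) * (1 + \<alpha>)) * (P * SD)"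
    proof -
      have "0 \<le> \<alpha> * e" "0 \<le> \<alpha> * r" using nonneg \<alpha>_pos by auto
      then have "\<alpha> * (1 + r) + 2 \<le> (e + r + 2) * (1 + \<alpha>)"
        using nonneg \<alpha>_pos by (simp add: algebra_simps)
      moreover have "e + r \<le> e + r + 2" "2 \<le> e + r + 2" using nonneg by auto
      ultimately show ?thesis
        using nonneg(3,5) nn \<alpha>_pos
        by (intro add_mono[OF add_mono] mult_right_mono) auto
    qed
    also have "\<dots> = (e + r + 2) * (\<alpha> * Q * SA + SR / b + (1 + \<alpha>) * P * SD)"
      by (simp add: distrib_left mult.assoc)
    finally have "3 powr p * (e * Q * \<alpha> * SA + 2 * SR / b + P * (\<alpha> * ((1 + r) * SD + r * (b powr (p - q) * SA)) + 2 * SD))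
      \<le> 3 powr p * ((e + r + 2) * (\<alpha> * Q * SA + SR / b + (1 + \<alpha>) * P * SD))"
      by (intro mult_left_mono) auto
    then show "3 powr p * (e * b powr (- q) * \<alpha> * SA + 2 * SR / b)
      + 3 powr p * b powr (- p) * (\<alpha> * ((1 + r) * SD + r * (b powr (p - q) * SA)) + 2 * SD)
      \<le> 3 powr p * (e + r + 2) * (\<alpha> * b powr (- q) * SA + SR / b + (1 + \<alpha>) * b powr (- p) * SD)"
      unfolding P_def Q_def mult.assoc[of "3 powr p"] distrib_left[of "3 powr p", symmetric] .
  qed
  finally show ?thesis
    unfolding r_def e_def SA_def SR_def SD_def
    by (simp add: sum.distrib sum_distrib_left sum_divide_distrib)
qed

end

section \<open>Summation over the rows\<close>

text \<open>Infinite sums in \<open>ennreal\<close> are suprema of finite partial sums, and each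
  finite partial sum obeys the bound by distributivity.\<close>

lemma infsum_cmult_ennreal_le:
  fixes f :: "'i \<Rightarrow> ennreal"
  shows "(\<Sum>\<^sub>\<infinity>i\<in>I. c * f i) \<le> c * (\<Sum>\<^sub>\<infinity>i\<in>I. f i)"
proof -
  have "(\<Sum>i\<in>J. c * f i) \<le> c * (\<Sum>\<^sub>\<infinity>i\<in>I. f i)" if "finite J" "J \<subseteq> I" for J
  proof -
    have "(\<Sum>i\<in>J. f i) \<le> (\<Sum>\<^sub>\<infinity>i\<in>I. f i)"
      using that by (subst nonneg_infsum_complete) (auto intro!: SUP_upper)
    then show ?thesis
      by (simp add: sum_distrib_left[symmetric] mult_left_mono)
  qed
  then show ?thesis
    by (subst nonneg_infsum_complete) (auto intro!: SUP_least)
qed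

theorem theorem2p1:
  fixes M :: "'a measure"
    and X :: "nat \<Rightarrow> nat \<Rightarrow> 'a \<Rightarrow> real"
    and p q :: real
    and \<alpha> b c :: "nat \<Rightarrow> real"
  assumes "prob_space M"
    and "p > 1"
    and "\<And>n k. 1 \<le> k \<Longrightarrow> k \<le> n \<Longrightarrow> X n k \<in> borel_measurable M"
    and "\<And>n k. 1 \<le> k \<Longrightarrow> k \<le> n \<Longrightarrow> integrable M (\<lambda>\<omega>. \<bar>X n k \<omega>\<bar> powr p)"
    and "q > p"
    and "\<And>n. n \<ge> 1 \<Longrightarrow> \<alpha> n > 0"
    and "\<And>n t. n \<ge> 1 \<Longrightarrow> t > 0 \<Longrightarrow>
           (\<integral>\<omega>. \<bar>\<Sum>k=1..n. trunc t (X n k \<omega>) - (\<integral>\<omega>'. trunc t (X n k \<omega>') \<partial>M)\<bar> powr q \<partial>M)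
             \<le> \<alpha> n * (\<Sum>k=1..n. \<integral>\<omega>. \<bar>trunc t (X n k \<omega>)\<bar> powr q \<partial>M)"
    and "\<And>n. n \<ge> 1 \<Longrightarrow> b n > 0"
    and "\<And>n. n \<ge> 1 \<Longrightarrow> c n > 0"
    and a: "(\<Sum>\<^sub>\<infinity>n\<in>{1..}. \<Sum>k=1..n. ennreal (\<alpha> n * c n * b n powr (- q)) *
              (\<integral>\<^sup>+t\<in>{0..b n powr q}. ennreal \<P>(\<omega> in M. \<bar>X n k \<omega>\<bar> powr q > t) \<partial>lborel)) < \<infinity>"
    and b: "(\<Sum>\<^sub>\<infinity>n\<in>{1..}. \<Sum>k=1..n. ennreal (c n) *
              (\<integral>\<^sup>+\<omega>. ennreal (\<bar>X n k \<omega>\<bar> * indicator {\<omega> \<in> space M. \<bar>X n k \<omega>\<bar> > b n} \<omega>) \<partial>M)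
              / ennreal (b n)) < \<infinity>"
    and c: "(\<Sum>\<^sub>\<infinity>n\<in>{1..}. \<Sum>k=1..n. ennreal ((1 + \<alpha> n) * c n * b n powr (- p)) *
              (\<integral>\<^sup>+t\<in>{b n powr p..}. ennreal \<P>(\<omega> in M. \<bar>X n k \<omega>\<bar> powr p > t) \<partial>lborel)) < \<infinity>"
  shows "\<forall>\<epsilon>>0. (\<Sum>\<^sub>\<infinity>n\<in>{1..}. ennreal (c n) *
           (\<integral>\<^sup>+\<omega>. ennreal (pos_part (\<bar>\<Sum>k=1..n. X n k \<omega> - (\<integral>\<omega>'. X n k \<omega>' \<partial>M)\<bar> / b n - \<epsilon>) powr p) \<partial>M)) < \<infinity>"
proof (intro allI impI)
  fix \<epsilon> :: real assume \<epsilon>: "0 < \<epsilon>"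
  \<comment> \<open>This constant is the same for all rows, so it can be pulled out of the sum over
    \<open>n\<close>.\<close>
  define C where "C = 3 powr p * (\<epsilon> powr (p - q) + p / (q - p) + 2)"
  have C: "0 \<le> C" unfolding C_def using assms(2,5) by auto
  let ?a = "\<lambda>n k. ennreal (\<alpha> n * c n * b n powr (- q)) *
    (\<integral>\<^sup>+t\<in>{0..b n powr q}. ennreal \<P>(\<omega> in M. \<bar>X n k \<omega>\<bar> powr q > t) \<partial>lborel)"
  let ?b = "\<lambda>n k. ennreal (c n) *
    (\<integral>\<^sup>+\<omega>. ennreal (\<bar>X n k \<omega>\<bar> * indicator {\<omega> \<in> space M. \<bar>X n k \<omega>\<bar> > b n} \<omega>) \<partial>M) / ennreal (b n)"
  let ?c = "\<lambda>n k. ennreal ((1 + \<alpha> n) * c n * b n powr (- p)) *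
    (\<integral>\<^sup>+t\<in>{b n powr p..}. ennreal \<P>(\<omega> in M. \<bar>X n k \<omega>\<bar> powr p > t) \<partial>lborel)"
  let ?L = "\<lambda>n. ennreal (c n) * (\<integral>\<^sup>+\<omega>. ennreal
    (pos_part (\<bar>\<Sum>k=1..n. X n k \<omega> - (\<integral>\<omega>'. X n k \<omega>' \<partial>M)\<bar> / b n - \<epsilon>) powr p) \<partial>M)"
  have bound: "?L n \<le> ennreal C * ((\<Sum>k=1..n. ?a n k) + (\<Sum>k=1..n. ?b n k) + (\<Sum>k=1..n. ?c n k))"
    if n: "n \<in> {1..}" for n
  proof -
    have n1: "1 \<le> n" using n by simp
    have pos: "0 < \<alpha> n" "0 < b n" "0 < c n" using assms(6,8,9) n1 by auto
    interpret truncated_moments M "{1..n}" "X n" p q "\<alpha> n" "b n"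
      using assms(1-7) n1 pos by (auto simp: truncated_moments_def truncated_moments_axioms_def)
    have a_eq: "ennreal (c n) * ennreal (\<alpha> n * b n powr (- q) * A (b n) k) = ?a n k" if k: "k \<in> {1..n}" for k
    proof -
      note [measurable] = X_measurable[OF k]
      have "(\<integral>\<^sup>+t\<in>{0..b n powr q}. ennreal \<P>(\<omega> in M. \<bar>X n k \<omega>\<bar> powr q > t) \<partial>lborel)
        = (\<integral>\<^sup>+\<omega>. ennreal (min (\<bar>X n k \<omega>\<bar> powr q) (b n powr q)) \<partial>M)"
        by (rule nn_integral_tail_Icc) auto
      also have "\<dots> = (\<integral>\<^sup>+\<omega>. ennreal (min \<bar>X n k \<omega>\<bar> (b n) powr q) \<partial>M)"
        using pos assms(2,5) by (simp add: min_powr)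
      also have "\<dots> = ennreal (A (b n) k)"
        unfolding A_def using A_integrable[OF k, of "b n"] pos by (intro nn_integral_eq_integral) auto
      finally show ?thesis
        using pos A_nonneg by (simp add: ennreal_mult[symmetric] mult_ac)
    qed
    \<comment> \<open>Unlike for (a) and (c), only an inequality holds: the excess over
      \<open>b n\<close> is bounded by the full absolute value on the event where it is
      positive.\<close>
    have b_le: "ennreal (c n) * ennreal (R (b n) k / b n) \<le> ?b n k" if k: "k \<in> {1..n}" for k
    proof -
      have "ennreal (R (b n) k) = (\<integral>\<^sup>+\<omega>. ennreal (max (\<bar>X n k \<omega>\<bar> - b n) 0) \<partial>M)"
        unfolding R_def using R_integrable[OF k pos(2)] by (intro nn_integral_eq_integral[symmetric]) auto
      also have "\<dots> \<le> (\<integral>\<^sup>+\<omega>. ennreal (\<bar>X n k \<omega>\<bar> * indicator {\<omega> \<in> space M. \<bar>X n k \<omega>\<bar> > b n} \<omega>) \<partial>M)"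
        using pos by (intro nn_integral_mono ennreal_leI) (auto split: split_indicator)
      finally show ?thesis
        using pos R_nonneg
        by (simp add: divide_ennreal[symmetric] ennreal_times_divide divide_right_mono_ennreal mult_left_mono)
    qed
    have c_eq: "ennreal (c n) * ennreal ((1 + \<alpha> n) * b n powr (- p) * D k) = ?c n k" if k: "k \<in> {1..n}" for k
    proof -
      note [measurable] = X_measurable[OF k]
      have "(\<integral>\<^sup>+t\<in>{b n powr p..}. ennreal \<P>(\<omega> in M. \<bar>X n k \<omega>\<bar> powr p > t) \<partial>lborel)
        = (\<integral>\<^sup>+\<omega>. ennreal (max (\<bar>X n k \<omega>\<bar> powr p - b n powr p) 0) \<partial>M)"
        by (rule nn_integral_tail_atLeast) auto
      also have "\<dots> = ennreal (D k)"
        unfolding D_def using D_integrable[OF k] by (intro nn_integral_eq_integral) auto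
      finally show ?thesis
        using pos D_nonneg by (simp add: ennreal_mult[symmetric] mult_ac)
    qed
    have "?L n \<le> ennreal (c n) * ennreal (C *
      (\<Sum>k=1..n. \<alpha> n * b n powr (- q) * A (b n) k + R (b n) k / b n + (1 + \<alpha> n) * b n powr (- p) * D k))"
      using nn_integral_F_powr[OF \<epsilon>] unfolding F_def S_def C_def by (intro mult_left_mono) auto
    also have "\<dots> = ennreal C * (\<Sum>k=1..n. ennreal (c n) * ennreal (\<alpha> n * b n powr (- q) * A (b n) k)
      + ennreal (c n) * ennreal (R (b n) k / b n) + ennreal (c n) * ennreal ((1 + \<alpha> n) * b n powr (- p) * D k))"
    proof -
      define f where "f k = \<alpha> n * b n powr (- q) * A (b n) k" for k
      define g where "g k = R (b n) k / b n" for k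
      define h where "h k = (1 + \<alpha> n) * b n powr (- p) * D k" for k
      have "0 \<le> f k" "0 \<le> g k" "0 \<le> h k" for k
        unfolding f_def g_def h_def using pos A_nonneg R_nonneg D_nonneg by auto
      then show ?thesis
        unfolding f_def[symmetric] g_def[symmetric] h_def[symmetric]
        using C pos by (simp add: ennreal_mult[symmetric] ennreal_plus[symmetric] sum_nonneg
          sum_distrib_left distrib_left mult_ac del: ennreal_plus)
    qed
    also have "\<dots> \<le> ennreal C * (\<Sum>k=1..n. ?a n k + ?b n k + ?c n k)"
      using a_eq b_le c_eq by (intro mult_left_mono sum_mono add_mono) auto
    finally show ?thesis by (simp add: sum.distrib)
  qed
  have "(\<Sum>\<^sub>\<infinity>n\<in>{1..}. ?L n)
    \<le> (\<Sum>\<^sub>\<infinity>n\<in>{1..}. ennreal C * ((\<Sum>k=1..n. ?a n k) + (\<Sum>k=1..n. ?b n k) + (\<Sum>k=1..n. ?c n k)))"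
    by (intro infsum_mono bound nonneg_summable_on_complete) auto
  also have "\<dots> \<le> ennreal C * ((\<Sum>\<^sub>\<infinity>n\<in>{1..}. \<Sum>k=1..n. ?a n k) + (\<Sum>\<^sub>\<infinity>n\<in>{1..}. \<Sum>k=1..n. ?b n k)
    + (\<Sum>\<^sub>\<infinity>n\<in>{1..}. \<Sum>k=1..n. ?c n k))"
    by (rule order_trans[OF infsum_cmult_ennreal_le]) (simp add: infsum_add nonneg_summable_on_complete)
  also have "\<dots> < \<infinity>"
    using a b c by (simp add: ennreal_mult_less_top)
  finally show "(\<Sum>\<^sub>\<infinity>n\<in>{1..}. ?L n) < \<infinity>" .
qed

end
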